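(* There is no minion homomorphism $\mathcal V_2\text{-}\mathbb Z_2\to\mathcal Z_8$.
   Context: A minion $\mathcal R$ is a functor from finite sets to sets: it assigns a set $\mathcal R^{(D)}$ to each finite set $D$ and a map $\mathcal R^{(\alpha)}:\mathcal R^{(D)}\to\mathcal R^{(E)}$ to each function $\alpha:D\to E$ between finite sets, preserving identities and composition. A minion homomorphism $\xi:\mathcal R\to\mathcal S$ is a natural transformation: a family of functions $\xi^{(D)}:\mathcal R^{(D)}\to\mathcal S^{(D)}$ with $\xi^{(E)}\circ\mathcal R^{(\alpha)}=\mathcal S^{(\alpha)}\circ\xi^{(D)}$ for every $\alpha:D\to E$. For $m\in\mathbb N$, the minion $\mathcal Z_m$ is given by $\mathcal Z_m^{(D)}=\{f:D\to\mathbb Z_m\mid\sum_{a\in D}f(a)=1\}$ (where $\mathbb Z_m$ is the ring of integers modulo $m$), and for $\alpha:D\to E$, $\mathcal Z_m^{(\alpha)}(f)(b)=\sum_{a\in\alpha^{-1}(b)}f(a)$. For a prime $p$, the minion $\mathcal V_2\text{-}\mathbb Z_p$ is defined as follows; all computations are in the field $\mathbb Z_p$. For vectors in $\mathbb Z_p^N$ let $\mathfrak w(v_1,\dots,v_N)=v_1+\cdots+v_N$ and let $\odot$ denote the componentwise product. For a finite set $D$, $(\mathcal V_2\text{-}\mathbb Z_p)^{(D)}$ is the set of triples $(V,\mathbf i,\mathbf v)$ where $V$ is a linear subspace of $\mathbb Z_p^N$ for some $N\in\mathbb N$, $\mathbf i\in V$, and $\mathbf v:D\to V$, such that: (i) $\mathbf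 i=(1,1,\dots,1)$ and $\mathfrak w(\mathbf i)=1$; (s) $\sum_{a\in D}\mathbf v(a)=\mathbf i$; (o) $\mathfrak w(\mathbf v(a)\odot\mathbf v(b))=0$ for all $a\ne b$ in $D$; (p) $\mathfrak w(\mathbf v(a)\odot\mathbf v(a))=\mathfrak w(\mathbf v(a))$ for all $a\in D$. For $\alpha:D\to E$, $(\mathcal V_2\text{-}\mathbb Z_p)^{(\alpha)}(V,\mathbf i,\mathbf v)=(V,\mathbf i,\mathbf v')$ with $\mathbf v'(b)=\sum_{a\in\alpha^{-1}(b)}\mathbf v(a)$. The claim concerns $p=2$. *)

theory Defs
  imports
    "HOL-Library.FuncSet"
    "HOL-Library.Infinite_Typeclass"
    "HOL-Number_Theory.Residues"
begin

text \<open>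
  HOL cannot quantify over all finite sets of all types at once. The finite sets are therefore the
  finite subsets of a type \<open>'a\<close>; whenever \<open>'a\<close> is infinite they form, with all functions
  between them, a category equivalent to that of all finite sets. A function \<open>D \<rightarrow> E\<close> is an element
  of the extensional function space \<open>D \<rightarrow>\<^sub>E E\<close>, so that equal functions are equal terms.
\<close>

record ('a, 'x) minion_data =
  obj :: "'a set \<Rightarrow> 'x set"
  arr :: "'a set \<Rightarrow> 'a set \<Rightarrow> ('a \<Rightarrow> 'a) \<Rightarrow> 'x \<Rightarrow> 'x"

definition minion :: "('a, 'x) minion_data \<Rightarrow> bool" where
  "minion R \<longleftrightarrow>
     (\<forall>D E \<alpha>. finite D \<and> finite E \<and> \<alpha> \<in> D \<rightarrow>\<^sub>E E \<longrightarrow> arr R D E \<alpha> \<in> obj R D \<rightarrow> obj R E) \<and>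
     (\<forall>D. finite D \<longrightarrow> (\<forall>x\<in>obj R D. arr R D D (restrict id D) x = x)) \<and>
     (\<forall>D E F \<alpha> \<beta>. finite D \<and> finite E \<and> finite F \<and> \<alpha> \<in> D \<rightarrow>\<^sub>E E \<and> \<beta> \<in> E \<rightarrow>\<^sub>E F \<longrightarrow>
        (\<forall>x\<in>obj R D. arr R D F (compose D \<beta> \<alpha>) x = arr R E F \<beta> (arr R D E \<alpha> x)))"

definition minion_hom ::
  "('a, 'x) minion_data \<Rightarrow> ('a, 'y) minion_data \<Rightarrow> ('a set \<Rightarrow> 'x \<Rightarrow> 'y) \<Rightarrow> bool" where
  "minion_hom R S \<xi> \<longleftrightarrow>
     (\<forall>D. finite D \<longrightarrow> \<xi> D \<in> obj R D \<rightarrow> obj S D) \<and>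
     (\<forall>D E \<alpha>. finite D \<and> finite E \<and> \<alpha> \<in> D \<rightarrow>\<^sub>E E \<longrightarrow>
        (\<forall>x\<in>obj R D. \<xi> E (arr R D E \<alpha> x) = arr S D E \<alpha> (\<xi> D x)))"

text \<open>
  The library's \<open>residue_ring m\<close> models the integers modulo \<open>m\<close> for \<open>m \<ge> 2\<close> only
  (for \<open>m = 1\<close> its unit lies outside its carrier).
\<close>

abbreviation Zmod :: "nat \<Rightarrow> int ring" where
  "Zmod m \<equiv> residue_ring (int m)"

definition Z_minion :: "nat \<Rightarrow> ('a, 'a \<Rightarrow> int) minion_data" where
  "Z_minion m = \<lparr>
     obj = (\<lambda>D. {f \<in> D \<rightarrow>\<^sub>E carrier (Zmod m). (\<Oplus>\<^bsub>Zmod m\<^esub>a\<in>D. f a) = \<one>\<^bsub>Zmod m\<^esub>}),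
     arr = (\<lambda>D E \<alpha> f. \<lambda>b\<in>E. \<Oplus>\<^bsub>Zmod m\<^esub>a\<in>{a \<in> D. \<alpha> a = b}. f a)\<rparr>"

text \<open>
  \<open>R\<^sup>N\<close>, with vectors as lists of length \<open>N\<close>. Besides the linear structure the record carries
  the componentwise product and the all-ones vector.
\<close>

definition vectors :: "('r, 'm) ring_scheme \<Rightarrow> nat \<Rightarrow> ('r, 'r list) module" where
  "vectors R N = \<lparr>
     carrier = {xs. length xs = N \<and> set xs \<subseteq> carrier R},
     monoid.mult = map2 (\<otimes>\<^bsub>R\<^esub>),
     one = replicate N \<one>\<^bsub>R\<^esub>,
     zero = replicate N \<zero>\<^bsub>R\<^esub>,
     add = map2 (\<oplus>\<^bsub>R\<^esub>),
     smult = (\<lambda>c. map ((\<otimes>\<^bsub>R\<^esub>) c))\<rparr>"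

definition weight :: "('r, 'm) ring_scheme \<Rightarrow> 'r list \<Rightarrow> 'r" where
  "weight R xs = (\<Oplus>\<^bsub>R\<^esub>k\<in>{..<length xs}. xs ! k)"

type_synonym 'a V2_elem = "int list set \<times> int list \<times> ('a \<Rightarrow> int list)"

text \<open>Meant for prime \<open>p\<close>. In the action on maps, \<open>N\<close> is read off as the length of \<open>i\<close>.\<close>

definition V2_minion :: "nat \<Rightarrow> ('a, 'a V2_elem) minion_data" where
  "V2_minion p = \<lparr>
     obj = (\<lambda>D. {(V, i, v). \<exists>N.
       submodule V (Zmod p) (vectors (Zmod p) N) \<and> i \<in> V \<and> v \<in> D \<rightarrow>\<^sub>E V \<and>
       i = \<one>\<^bsub>vectors (Zmod p) N\<^esub> \<and> weight (Zmod p) i = \<one>\<^bsub>Zmod p\<^esub> \<and>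
       (\<Oplus>\<^bsub>vectors (Zmod p) N\<^esub>a\<in>D. v a) = i \<and>
       (\<forall>a\<in>D. \<forall>b\<in>D. a \<noteq> b \<longrightarrow>
          weight (Zmod p) (v a \<otimes>\<^bsub>vectors (Zmod p) N\<^esub> v b) = \<zero>\<^bsub>Zmod p\<^esub>) \<and>
       (\<forall>a\<in>D. weight (Zmod p) (v a \<otimes>\<^bsub>vectors (Zmod p) N\<^esub> v a) = weight (Zmod p) (v a))}),
     arr = (\<lambda>D E \<alpha> (V, i, v).
       (V, i, \<lambda>b\<in>E. \<Oplus>\<^bsub>vectors (Zmod p) (length i)\<^esub>a\<in>{a \<in> D. \<alpha> a = b}. v a))\<rparr>"


lemma (in abelian_monoid) finsum_fibres:
  assumes "finite D" "finite E" "\<alpha> \<in> D \<rightarrow> E" "f \<in> D \<rightarrow> carrier G"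
  shows "(\<Oplus>b\<in>E. \<Oplus>a\<in>{a \<in> D. \<alpha> a = b}. f a) = (\<Oplus>a\<in>D. f a)"
proof -
  have D: "D = (\<Union>b\<in>E. {a \<in> D. \<alpha> a = b})"
    using assms(3) by auto
  have "finsum G f (\<Union>b\<in>E. {a \<in> D. \<alpha> a = b}) = (\<Oplus>b\<in>E. finsum G f {a \<in> D. \<alpha> a = b})"
    using assms by (intro add.finprod_UN_disjoint) (auto simp: pairwise_def disjnt_def)
  then show ?thesis
    using D by simp
qed

lemma (in abelian_monoid) finsum_fibres_fibre:
  assumes "finite D" "finite E" "\<alpha> \<in> D \<rightarrow> E" "f \<in> D \<rightarrow> carrier G"
  shows "(\<Oplus>b\<in>{b \<in> E. \<beta> b = c}. \<Oplus>a\<in>{a \<in> D. \<alpha> a = b}. f a)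
       = (\<Oplus>a\<in>{a \<in> D. \<beta> (\<alpha> a) = c}. f a)"
proof -
  let ?D = "{a \<in> D. \<beta> (\<alpha> a) = c}" and ?E = "{b \<in> E. \<beta> b = c}"
  have "(\<Oplus>b\<in>?E. \<Oplus>a\<in>{a \<in> D. \<alpha> a = b}. f a) = (\<Oplus>b\<in>?E. \<Oplus>a\<in>{a \<in> ?D. \<alpha> a = b}. f a)"
  proof (rule finsum_cong')
    show "(\<lambda>b. \<Oplus>a\<in>{a \<in> ?D. \<alpha> a = b}. f a) \<in> ?E \<rightarrow> carrier G"
      using assms by (auto intro!: finsum_closed)
  next
    fix b assume "b \<in> ?E"
    then have "{a \<in> D. \<alpha> a = b} = {a \<in> ?D. \<alpha> a = b}" by auto
    then show "(\<Oplus>a\<in>{a \<in> D. \<alpha> a = b}. f a) = (\<Oplus>a\<in>{a \<in> ?D. \<alpha> a = b}. f a)" by simp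
  qed simp
  also have "\<dots> = (\<Oplus>a\<in>?D. f a)"
    using assms by (intro finsum_fibres) auto
  finally show ?thesis .
qed

lemma (in abelian_monoid) finsum_fibre_id:
  assumes "f \<in> D \<rightarrow>\<^sub>E carrier G"
  shows "(\<lambda>b\<in>D. \<Oplus>a\<in>{a \<in> D. restrict id D a = b}. f a) = f"
proof
  fix b
  have "{a \<in> D. restrict id D a = b} = {b}" if "b \<in> D"
    using that by auto
  then show "(\<lambda>b\<in>D. \<Oplus>a\<in>{a \<in> D. restrict id D a = b}. f a) b = f b"
    using assms by (cases "b \<in> D") (auto simp: PiE_def extensional_def Pi_def finsum_singleton)
qed

lemma (in abelian_monoid) finsum_fibre_compose:
  assumes "finite D" "finite E" "\<alpha> \<in> D \<rightarrow> E" "f \<in> D \<rightarrow> carrier G"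
  shows "(\<lambda>c\<in>F. \<Oplus>a\<in>{a \<in> D. compose D \<beta> \<alpha> a = c}. f a)
    = (\<lambda>c\<in>F. finsum G (\<lambda>b\<in>E. \<Oplus>a\<in>{a \<in> D. \<alpha> a = b}. f a) {b \<in> E. \<beta> b = c})"
proof
  fix c
  have D: "{a \<in> D. compose D \<beta> \<alpha> a = c} = {a \<in> D. \<beta> (\<alpha> a) = c}"
    by (auto simp: compose_def)
  have "finsum G (\<lambda>b\<in>E. \<Oplus>a\<in>{a \<in> D. \<alpha> a = b}. f a) {b \<in> E. \<beta> b = c}
      = (\<Oplus>b\<in>{b \<in> E. \<beta> b = c}. \<Oplus>a\<in>{a \<in> D. \<alpha> a = b}. f a)"
    using assms by (intro finsum_cong') (auto intro!: finsum_closed)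
  then show "(\<lambda>c\<in>F. \<Oplus>a\<in>{a \<in> D. compose D \<beta> \<alpha> a = c}. f a) c
    = (\<lambda>c\<in>F. finsum G (\<lambda>b\<in>E. \<Oplus>a\<in>{a \<in> D. \<alpha> a = b}. f a) {b \<in> E. \<beta> b = c}) c"
    using finsum_fibres_fibre[OF assms, of \<beta> c] by (simp add: D)
qed

lemma minion_Z_minion:
  assumes "m \<ge> 2"
  shows "minion (Z_minion m)"
proof -
  interpret residues "int m" "Zmod m"
    using assms by (unfold_locales) auto
  interpret cring "Zmod m" by (rule cring)
  show ?thesis
    unfolding minion_def
  proof (intro conjI allI impI ballI, goal_cases)
    case (1 D E \<alpha>)
    show ?case
    proof
      fix f assume "f \<in> obj (Z_minion m) D"
      then have f: "f \<in> D \<rightarrow>\<^sub>E carrier (Zmod m)" "(\<Oplus>\<^bsub>Zmod m\<^esub>a\<in>D. f a) = \<one>\<^bsub>Zmod m\<^esub>"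
        by (auto simp: Z_minion_def)
      let ?g = "\<lambda>b. \<Oplus>\<^bsub>Zmod m\<^esub>a\<in>{a \<in> D. \<alpha> a = b}. f a"
      have g: "?g b \<in> carrier (Zmod m)" for b
        using f by (intro finsum_closed) auto
      have "finsum (Zmod m) (restrict ?g E) E = finsum (Zmod m) ?g E"
        using g by (intro finsum_cong') auto
      also have "\<dots> = \<one>\<^bsub>Zmod m\<^esub>"
        using finsum_fibres[of D E \<alpha> f] f 1 by auto
      finally show "arr (Z_minion m) D E \<alpha> f \<in> obj (Z_minion m) E"
        using g by (simp add: Z_minion_def)
    qed
  next
    case (2 D f)
    then show ?case
      using finsum_fibre_id[of f D] by (simp add: Z_minion_def)
  next
    case (3 D E F \<alpha> \<beta> f)
    then show ?case
      using finsum_fibre_compose[of D E \<alpha> f \<beta> F] by (auto simp: Z_minion_def)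
  qed
qed

context cring
begin

lemma vectors_carrier_iff:
  "x \<in> carrier (vectors R N) \<longleftrightarrow> length x = N \<and> (\<forall>k<N. x ! k \<in> carrier R)"
  by (auto simp: vectors_def subset_iff set_conv_nth)

lemma vectors_ops:
  "\<one>\<^bsub>vectors R N\<^esub> = replicate N \<one>" "\<zero>\<^bsub>vectors R N\<^esub> = replicate N \<zero>"
  "x \<otimes>\<^bsub>vectors R N\<^esub> y = map2 (\<otimes>) x y" "x \<oplus>\<^bsub>vectors R N\<^esub> y = map2 (\<oplus>) x y"
  by (simp_all add: vectors_def)

lemma cring_vectors: "cring (vectors R N)"
proof (rule cringI)
  show "abelian_group (vectors R N)"
  proof (rule abelian_groupI)
    fix x assume x: "x \<in> carrier (vectors R N)"
    show "\<exists>y\<in>carrier (vectors R N). y \<oplus>\<^bsub>vectors R N\<^esub> x = \<zero>\<^bsub>vectors R N\<^esub>"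
      using x by (intro bexI[of _ "map (a_inv R) x"])
        (auto simp: vectors_carrier_iff vectors_ops intro!: nth_equalityI l_neg)
  qed (auto simp: vectors_carrier_iff vectors_ops intro!: nth_equalityI a_assoc a_comm l_zero)
  show "comm_monoid (vectors R N)"
    by (rule comm_monoidI)
      (auto simp: vectors_carrier_iff vectors_ops intro!: nth_equalityI m_assoc m_comm)
qed (auto simp: vectors_carrier_iff vectors_ops intro!: nth_equalityI l_distr)

lemma weight_closed: "x \<in> carrier (vectors R N) \<Longrightarrow> weight R x \<in> carrier R"
  unfolding weight_def by (rule finsum_closed) (auto simp: vectors_carrier_iff)

lemma weight_zero: "weight R \<zero>\<^bsub>vectors R N\<^esub> = \<zero>"
  unfolding weight_def by (auto simp: vectors_def intro!: add.finprod_one_eqI)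

lemma weight_add:
  assumes "x \<in> carrier (vectors R N)" "y \<in> carrier (vectors R N)"
  shows "weight R (x \<oplus>\<^bsub>vectors R N\<^esub> y) = weight R x \<oplus> weight R y"
proof -
  have [simp]: "length x = N" "length y = N"
    using assms by (auto simp: vectors_def)
  have "x ! k \<in> carrier R" "y ! k \<in> carrier R" if "k < N" for k
    using assms that by (auto simp: vectors_def subset_iff set_conv_nth)
  then have "(\<Oplus>k\<in>{..<N}. x ! k \<oplus> y ! k) = (\<Oplus>k\<in>{..<N}. x ! k) \<oplus> (\<Oplus>k\<in>{..<N}. y ! k)"
    by (intro finsum_addf) auto
  moreover have "(\<Oplus>k\<in>{..<N}. (x \<oplus>\<^bsub>vectors R N\<^esub> y) ! k) = (\<Oplus>k\<in>{..<N}. x ! k \<oplus> y ! k)"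
    using \<open>\<And>k. k < N \<Longrightarrow> x ! k \<in> carrier R\<close> \<open>\<And>k. k < N \<Longrightarrow> y ! k \<in> carrier R\<close>
    by (intro finsum_cong') (auto simp: vectors_def)
  ultimately show ?thesis
    by (simp add: weight_def vectors_def)
qed

lemma weight_finsum:
  assumes "finite A" "f \<in> A \<rightarrow> carrier (vectors R N)"
  shows "weight R (\<Oplus>\<^bsub>vectors R N\<^esub>a\<in>A. f a) = (\<Oplus>a\<in>A. weight R (f a))"
proof -
  interpret v: cring "vectors R N" by (rule cring_vectors)
  show ?thesis
    using assms
  proof (induction A rule: finite_induct)
    case empty
    then show ?case by (simp add: weight_zero)
  next
    case (insert a A)
    then have "weight R (f b) \<in> carrier R" if "b \<in> insert a A" for b
      using that by (auto intro!: weight_closed)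
    with insert show ?case
      by (subst v.finsum_insert) (auto simp: weight_add Pi_def)
  qed
qed

lemma weight_finsum_mult:
  assumes "finite A" "finite B"
    and "f \<in> A \<rightarrow> carrier (vectors R N)" "g \<in> B \<rightarrow> carrier (vectors R N)"
  shows "weight R ((\<Oplus>\<^bsub>vectors R N\<^esub>a\<in>A. f a) \<otimes>\<^bsub>vectors R N\<^esub> (\<Oplus>\<^bsub>vectors R N\<^esub>b\<in>B. g b))
    = (\<Oplus>a\<in>A. \<Oplus>b\<in>B. weight R (f a \<otimes>\<^bsub>vectors R N\<^esub> g b))"
proof -
  interpret v: cring "vectors R N" by (rule cring_vectors)
  have gB: "finsum (vectors R N) g B \<in> carrier (vectors R N)"
    using assms by (intro v.finsum_closed) auto
  have "weight R (finsum (vectors R N) f A \<otimes>\<^bsub>vectors R N\<^esub> finsum (vectors R N) g B)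
     = (\<Oplus>a\<in>A. weight R (f a \<otimes>\<^bsub>vectors R N\<^esub> finsum (vectors R N) g B))"
    using assms gB by (subst v.finsum_ldistr) (auto intro!: weight_finsum)
  also have "\<dots> = (\<Oplus>a\<in>A. \<Oplus>b\<in>B. weight R (f a \<otimes>\<^bsub>vectors R N\<^esub> g b))"
  proof (rule finsum_cong')
    fix a assume a: "a \<in> A"
    then have "f a \<in> carrier (vectors R N)" using assms by auto
    then show "weight R (f a \<otimes>\<^bsub>vectors R N\<^esub> finsum (vectors R N) g B)
      = (\<Oplus>b\<in>B. weight R (f a \<otimes>\<^bsub>vectors R N\<^esub> g b))"
      using assms by (subst v.finsum_rdistr) (auto intro!: weight_finsum)
  next
    show "(\<lambda>a. \<Oplus>b\<in>B. weight R (f a \<otimes>\<^bsub>vectors R N\<^esub> g b)) \<in> A \<rightarrow> carrier R"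
      using assms by (auto intro!: finsum_closed weight_closed[of _ N] v.m_closed)
  qed simp
  finally show ?thesis .
qed

lemma submodule_finsum_closed:
  assumes "submodule V R (vectors R N)" "finite A" "f \<in> A \<rightarrow> V"
  shows "(\<Oplus>\<^bsub>vectors R N\<^esub>a\<in>A. f a) \<in> V"
proof -
  interpret v: cring "vectors R N" by (rule cring_vectors)
  interpret V: submodule V R "vectors R N" by fact
  have sub: "V \<subseteq> carrier (vectors R N)" using V.subset by simp
  show ?thesis
    using assms(2,3)
  proof (induction A rule: finite_induct)
    case empty
    then show ?case using V.one_closed by simp
  next
    case (insert a A)
    then show ?case
      using sub V.m_closed by (subst v.finsum_insert) (auto simp: Pi_def)
  qed
qed

end

lemma minion_V2_minion:
  assumes "p \<ge> 2"
  shows "minion (V2_minion p)"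
proof -
  interpret residues "int p" "Zmod p"
    using assms by (unfold_locales) auto
  interpret cring "Zmod p" by (rule cring)
  let ?R = "Zmod p"
  show ?thesis
    unfolding minion_def
  proof (intro conjI allI impI ballI, goal_cases)
    case (1 D E \<alpha>)
    show ?case
    proof
      fix x assume x: "x \<in> obj (V2_minion p) D"
      obtain V i v where xe: "x = (V, i, v)" by (cases x)
      from x xe obtain N where V: "submodule V ?R (vectors ?R N)" "i \<in> V" and v: "v \<in> D \<rightarrow>\<^sub>E V"
        and i: "i = \<one>\<^bsub>vectors ?R N\<^esub>" "weight ?R i = \<one>\<^bsub>?R\<^esub>"
        and s: "(\<Oplus>\<^bsub>vectors ?R N\<^esub>a\<in>D. v a) = i"
        and ortho: "\<forall>a\<in>D. \<forall>b\<in>D. a \<noteq> b \<longrightarrow> weight ?R (v a \<otimes>\<^bsub>vectors ?R N\<^esub> v b) = \<zero>\<^bsub>?R\<^esub>"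
        and proj: "\<forall>a\<in>D. weight ?R (v a \<otimes>\<^bsub>vectors ?R N\<^esub> v a) = weight ?R (v a)"
        by (auto simp: V2_minion_def)
      interpret v: cring "vectors ?R N" by (rule cring_vectors)
      have N: "length i = N"
        using i by (simp add: vectors_def)
      have sub: "V \<subseteq> carrier (vectors ?R N)"
        using V(1) by (simp add: submodule_def subgroup_def)
      have vc: "v a \<in> carrier (vectors ?R N)" if "a \<in> D" for a
        using that v sub by auto
      let ?w = "\<lambda>b. \<Oplus>\<^bsub>vectors ?R N\<^esub>a\<in>{a \<in> D. \<alpha> a = b}. v a"
      have wV: "?w b \<in> V" for b
        using v 1 by (intro submodule_finsum_closed V) auto
      then have wc: "?w b \<in> carrier (vectors ?R N)" for b
        using sub by auto
      have "finsum (vectors ?R N) (restrict ?w E) E = finsum (vectors ?R N) ?w E"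
        using wc by (intro v.finsum_cong') auto
      also have "\<dots> = i"
        using v.finsum_fibres[of D E \<alpha> v] vc s 1 by auto
      finally have s': "finsum (vectors ?R N) (restrict ?w E) E = i" .
      have w2: "weight ?R (?w b \<otimes>\<^bsub>vectors ?R N\<^esub> ?w c)
        = (\<Oplus>\<^bsub>?R\<^esub>a\<in>{a \<in> D. \<alpha> a = b}. \<Oplus>\<^bsub>?R\<^esub>a'\<in>{a \<in> D. \<alpha> a = c}.
             weight ?R (v a \<otimes>\<^bsub>vectors ?R N\<^esub> v a'))" for b c
        using 1 vc by (intro weight_finsum_mult) auto
      have o': "weight ?R (?w b \<otimes>\<^bsub>vectors ?R N\<^esub> ?w c) = \<zero>\<^bsub>?R\<^esub>" if "b \<noteq> c" for b c
        unfolding w2 using that ortho by (auto intro!: add.finprod_one_eqI)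
      have p': "weight ?R (?w b \<otimes>\<^bsub>vectors ?R N\<^esub> ?w b) = weight ?R (?w b)" for b
      proof -
        let ?F = "{a \<in> D. \<alpha> a = b}"
        have "(\<Oplus>\<^bsub>?R\<^esub>a\<in>?F. \<Oplus>\<^bsub>?R\<^esub>a'\<in>?F. weight ?R (v a \<otimes>\<^bsub>vectors ?R N\<^esub> v a'))
          = (\<Oplus>\<^bsub>?R\<^esub>a\<in>?F. weight ?R (v a))"
        proof (rule finsum_cong')
          fix a assume a: "a \<in> ?F"
          have "(\<Oplus>\<^bsub>?R\<^esub>a'\<in>?F. weight ?R (v a \<otimes>\<^bsub>vectors ?R N\<^esub> v a'))
            = (\<Oplus>\<^bsub>?R\<^esub>a'\<in>?F. if a = a' then weight ?R (v a') else \<zero>\<^bsub>?R\<^esub>)"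
            using a ortho proj vc
            by (intro finsum_cong') (auto intro!: weight_closed[of _ N] zero_closed)
          also have "\<dots> = weight ?R (v a)"
            using a 1 vc by (intro add.finprod_singleton) (auto intro!: weight_closed[of _ N])
          finally show "(\<Oplus>\<^bsub>?R\<^esub>a'\<in>?F. weight ?R (v a \<otimes>\<^bsub>vectors ?R N\<^esub> v a')) = weight ?R (v a)" .
        qed (use vc in \<open>auto intro!: weight_closed[of _ N]\<close>)
        also have "\<dots> = weight ?R (?w b)"
          using 1 vc by (intro weight_finsum[symmetric]) auto
        finally show ?thesis unfolding w2 .
      qed
      show "arr (V2_minion p) D E \<alpha> x \<in> obj (V2_minion p) E"
        unfolding xe V2_minion_def
        by (simp add: N, rule exI[of _ N]) (use V wV i s' o' p' in auto)
    qed
  next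
    case (2 D x)
    obtain V i v where xe: "x = (V, i, v)" by (cases x)
    with 2 obtain N where V: "submodule V ?R (vectors ?R N)" and v: "v \<in> D \<rightarrow>\<^sub>E V"
      and i: "i = \<one>\<^bsub>vectors ?R N\<^esub>"
      by (auto simp: V2_minion_def)
    interpret v: cring "vectors ?R N" by (rule cring_vectors)
    have "V \<subseteq> carrier (vectors ?R N)" and [simp]: "length i = N"
      using V i by (auto simp: submodule_def subgroup_def vectors_def)
    then have "v \<in> D \<rightarrow>\<^sub>E carrier (vectors ?R N)"
      using v by auto
    then show ?case
      using v.finsum_fibre_id[of v D] by (simp add: V2_minion_def xe)
  next
    case (3 D E F \<alpha> \<beta> x)
    obtain V i v where xe: "x = (V, i, v)" by (cases x)
    with 3 obtain N where V: "submodule V ?R (vectors ?R N)" and v: "v \<in> D \<rightarrow>\<^sub>E V"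
      and i: "i = \<one>\<^bsub>vectors ?R N\<^esub>"
      by (auto simp: V2_minion_def)
    interpret v: cring "vectors ?R N" by (rule cring_vectors)
    have "V \<subseteq> carrier (vectors ?R N)" and [simp]: "length i = N"
      using V i by (auto simp: submodule_def subgroup_def vectors_def)
    then have "v \<in> D \<rightarrow> carrier (vectors ?R N)"
      using v by auto
    then show ?case
      using v.finsum_fibre_compose[of D E \<alpha> v \<beta> F] 3 by (simp add: V2_minion_def xe PiE_def)
  qed
qed

end

theory Submission
  imports Defs
begin

text \<open>
  By naturality under the maps that collapse all of \<open>D\<close> except one element, the value of a
  homomorphism \<open>\<xi>\<close> on \<open>(V, i, v)\<close> at \<open>a\<close> depends only on \<open>v a\<close>; call it \<open>F (v a)\<close>.
  Take \<open>N = 3\<close>, unit vectors \<open>e\<^sub>k\<close> and \<open>u\<^sub>k = (1,1,1) - e\<^sub>k\<close>. The tuples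
  \<open>(e\<^sub>k, u\<^sub>k)\<close> and \<open>(e\<^sub>k, u\<^sub>k, u\<^sub>k, u\<^sub>k)\<close> both lie in the minion, since \<open>u\<^sub>k\<close> is
  self-orthogonal. Hence \<open>F e\<^sub>k + F u\<^sub>k = 1 = F e\<^sub>k + 3 F u\<^sub>k\<close>, so \<open>2 F e\<^sub>k = 2\<close>. The tuple
  \<open>(e\<^sub>1, e\<^sub>2, e\<^sub>3)\<close> gives \<open>F e\<^sub>1 + F e\<^sub>2 + F e\<^sub>3 = 1\<close>, and doubling yields \<open>6 = 2\<close> in
  \<open>\<int>\<^sub>8\<close>.
\<close>

lemma (in residues) finsum_res_eq:
  assumes "finite A" "f \<in> A \<rightarrow> carrier R"
  shows "(\<Oplus>a\<in>A. f a) = (\<Sum>a\<in>A. f a) mod m"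
  using assms
proof (induction A rule: finite_induct)
  case empty
  then show ?case by (simp add: res_zero_eq)
next
  case (insert a A)
  then show ?case
    by (subst finsum_insert) (auto simp: res_add_eq mod_add_right_eq)
qed

text \<open>The existential \<open>N\<close> is replaced by \<open>length i\<close>, from which
  \<open>arr\<close> also reads the dimension. Triples with the same \<open>i\<close> thus live in
  one common module.\<close>

lemma V2_minion_objD:
  assumes "(V, i, v) \<in> obj (V2_minion p) D"
  shows "v \<in> D \<rightarrow> carrier (vectors (Zmod p) (length i))"
    and "(\<Oplus>\<^bsub>vectors (Zmod p) (length i)\<^esub>a\<in>D. v a) = i"
proof -
  obtain N where V: "submodule V (Zmod p) (vectors (Zmod p) N)" and v: "v \<in> D \<rightarrow>\<^sub>E V"
    and i: "i = \<one>\<^bsub>vectors (Zmod p) N\<^esub>"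
    and s: "(\<Oplus>\<^bsub>vectors (Zmod p) N\<^esub>a\<in>D. v a) = i"
    using assms by (auto simp: V2_minion_def)
  have N: "length i = N" using i by (simp add: vectors_def)
  have "V \<subseteq> carrier (vectors (Zmod p) N)"
    using V by (simp add: submodule_def subgroup_def)
  then show "v \<in> D \<rightarrow> carrier (vectors (Zmod p) (length i))"
    using v by (auto simp: N)
  show "(\<Oplus>\<^bsub>vectors (Zmod p) (length i)\<^esub>a\<in>D. v a) = i"
    using s by (simp only: N)
qed

lemma (in abelian_monoid) finsum_single:
  assumes "f a \<in> carrier G"
  shows "(\<Oplus>t\<in>{a}. f t) = f a"
  using assms finsum_insert[of "{}" a f] by simp

lemma (in abelian_group) finsum_minus_singleton:
  assumes "finite A" "a \<in> A" "f \<in> A \<rightarrow> carrier G"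
  shows "(\<Oplus>t\<in>A - {a}. f t) = (\<Oplus>t\<in>A. f t) \<ominus> f a"
proof -
  have c: "f a \<in> carrier G" "(\<Oplus>t\<in>A - {a}. f t) \<in> carrier G"
    using assms by (auto intro!: finsum_closed)
  have "(\<Oplus>t\<in>insert a (A - {a}). f t) = f a \<oplus> (\<Oplus>t\<in>A - {a}. f t)"
    using assms by (intro finsum_insert) auto
  then show ?thesis
    using assms(2) c by (simp add: insert_absorb minus_eq a_assoc[symmetric] a_comm[of "f a"] a_assoc r_neg)
qed

lemma minion_hom_closed:
  "minion_hom R S \<xi> \<Longrightarrow> finite D \<Longrightarrow> x \<in> obj R D \<Longrightarrow> \<xi> D x \<in> obj S D"
  by (auto simp: minion_hom_def)

lemma minion_hom_natural:
  assumes "minion_hom R S \<xi>" "x \<in> obj R D" "finite D" "finite E" "\<alpha> \<in> D \<rightarrow>\<^sub>E E"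
  shows "\<xi> E (arr R D E \<alpha> x) = arr S D E \<alpha> (\<xi> D x)"
  using assms by (simp add: minion_hom_def)

text \<open>Both triples have the same image over a two-element set: keeping one index and merging
  all others gives the pair of \<open>v a\<close> and \<open>i\<close> minus \<open>v a\<close>,
  because the vectors sum to \<open>i\<close>. In \<open>Z_minion\<close> the kept index has a
  singleton fibre, so its value survives the merging.\<close>

lemma minion_hom_value_eq:
  fixes \<xi> :: "'a::infinite set \<Rightarrow> 'a V2_elem \<Rightarrow> 'a \<Rightarrow> int"
  assumes hom: "minion_hom (V2_minion p) (Z_minion m) \<xi>" and pm: "p \<ge> 2" "m \<ge> 2"
    and D: "finite D" "(V, i, v) \<in> obj (V2_minion p) D" "a \<in> D"
    and E: "finite E" "(V, i, w) \<in> obj (V2_minion p) E" "b \<in> E" and vw: "v a = w b"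
  shows "\<xi> D (V, i, v) a = \<xi> E (V, i, w) b"
proof -
  interpret rp: residues "int p" "Zmod p"
    using pm by unfold_locales auto
  interpret rp: cring "Zmod p" by (rule rp.cring)
  interpret residues "int m" "Zmod m"
    using pm by unfold_locales auto
  let ?M = "vectors (Zmod p) (length i)"
  interpret v: cring ?M by (rule rp.cring_vectors)
  \<comment> \<open>Any two distinct elements will do as the target set; \<open>undefined\<close>
    serves as the second one.\<close>
  obtain x :: 'a where "x \<notin> {undefined}"
    using ex_new_if_finite[OF infinite_UNIV, of "{undefined :: 'a}"] by blast
  then obtain y :: 'a where xy: "x \<noteq> y" by blast
  let ?c = "\<lambda>D a. \<lambda>t\<in>D. if t = a then x else y"
  let ?s = "\<lambda>D v a. (\<Oplus>\<^bsub>?M\<^esub>t\<in>D - {a}. v t)"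
  have arr: "arr (V2_minion p) D {x, y} (?c D a) (V, i, v)
      = (V, i, \<lambda>t\<in>{x,y}. if t = x then v a else ?s D v a)"
    and val: "\<xi> {x, y} (arr (V2_minion p) D {x, y} (?c D a) (V, i, v)) x = \<xi> D (V, i, v) a"
    if X: "finite D" "(V, i, v) \<in> obj (V2_minion p) D" "a \<in> D" for D v a
  proof -
    have x: "{t \<in> D. ?c D a t = x} = {a}" and y: "{t \<in> D. ?c D a t = y} = D - {a}"
      using xy \<open>a \<in> D\<close> by (auto split: if_splits)
    have va: "v a \<in> carrier ?M" using V2_minion_objD(1)[OF X(2)] X(3) by auto
    note sa = v.finsum_single[of v, OF va]
    show "arr (V2_minion p) D {x, y} (?c D a) (V, i, v)
      = (V, i, \<lambda>t\<in>{x,y}. if t = x then v a else ?s D v a)"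
      unfolding V2_minion_def minion_data.simps prod.case
      by (intro arg_cong[where f = "\<lambda>w. (V, i, w)"] restrict_ext)
        (elim insertE emptyE; simp only: x y sa xy[symmetric] simp_thms if_True if_False)
    have c: "?c D a \<in> D \<rightarrow>\<^sub>E {x, y}" by auto
    have "\<xi> D (V, i, v) \<in> obj (Z_minion m) D"
      using X by (intro minion_hom_closed[OF hom])
    then have "\<xi> D (V, i, v) a \<in> carrier (Zmod m)"
      using X by (auto simp: Z_minion_def)
    moreover have "arr (Z_minion m) D {x, y} (?c D a) (\<xi> D (V, i, v)) x
        = (\<Oplus>\<^bsub>Zmod m\<^esub>t\<in>{t \<in> D. ?c D a t = x}. \<xi> D (V, i, v) t)"
      unfolding Z_minion_def minion_data.simps by (simp only: restrict_apply insert_iff simp_thms if_True)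
    ultimately have "arr (Z_minion m) D {x, y} (?c D a) (\<xi> D (V, i, v)) x = \<xi> D (V, i, v) a"
      unfolding x by (simp only: finsum_single)
    moreover have "\<xi> {x, y} (arr (V2_minion p) D {x, y} (?c D a) (V, i, v))
        = arr (Z_minion m) D {x, y} (?c D a) (\<xi> D (V, i, v))"
      by (intro minion_hom_natural[OF hom X(2,1) _ c]) simp
    ultimately show "\<xi> {x, y} (arr (V2_minion p) D {x, y} (?c D a) (V, i, v)) x = \<xi> D (V, i, v) a"
      by simp
  qed
  \<comment> \<open>Each merged sum is \<open>i\<close> minus the kept vector, and \<open>vw\<close>
    equates the kept vectors.\<close>
  have s: "?s D v a = ?s E w b"
    using v.finsum_minus_singleton[OF D(1,3) V2_minion_objD(1)[OF D(2)]]
      v.finsum_minus_singleton[OF E(1,3) V2_minion_objD(1)[OF E(2)]]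
      V2_minion_objD(2)[OF D(2)] V2_minion_objD(2)[OF E(2)] vw
    by simp
  have "arr (V2_minion p) D {x, y} (?c D a) (V, i, v)
      = arr (V2_minion p) E {x, y} (?c E b) (V, i, w)"
    unfolding arr[OF D] arr[OF E] vw s ..
  then show ?thesis
    using val[OF D] val[OF E] by simp
qed

lemma (in residues) weight_res_eq:
  assumes "set xs \<subseteq> carrier R"
  shows "weight R xs = sum_list xs mod m"
  unfolding weight_def using assms
  by (subst finsum_res_eq) (auto simp: sum_list_sum_nth atLeast0LessThan)

lemma (in cring) submodule_vectors: "submodule (carrier (vectors R N)) R (vectors R N)"
proof -
  interpret v: cring "vectors R N" by (rule cring_vectors)
  have "subgroup (carrier (vectors R N)) (add_monoid (vectors R N))"
    using v.add.subgroup_self by simp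
  then show ?thesis
    by (rule submodule.intro) (auto intro!: submodule_axioms.intro m_closed simp: vectors_def subset_iff)
qed

text \<open>Only the sum and orthogonality need checking: (1,1,1) has weight 3, which is 1 modulo 2,
  and 0 and 1 are idempotent, so every vector equals its componentwise square.\<close>

lemma V2_minion_2_objI:
  fixes v :: "'a \<Rightarrow> int list"
  assumes "v \<in> D \<rightarrow>\<^sub>E carrier (vectors (residue_ring 2) 3)"
    and "(\<Oplus>\<^bsub>vectors (residue_ring 2) 3\<^esub>a\<in>D. v a) = [1, 1, 1]"
    and "\<And>a b. a \<in> D \<Longrightarrow> b \<in> D \<Longrightarrow> a \<noteq> b \<Longrightarrow>
      weight (residue_ring 2) (v a \<otimes>\<^bsub>vectors (residue_ring 2) 3\<^esub> v b) = 0"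
  shows "(carrier (vectors (residue_ring 2) 3), [1, 1, 1], v) \<in> obj (V2_minion 2) D"
proof -
  interpret residues 2 "residue_ring 2"
    by unfold_locales auto
  interpret cring "residue_ring 2" by (rule cring)
  have one: "[1, 1, 1] = \<one>\<^bsub>vectors (residue_ring 2) 3\<^esub>"
    by (simp add: vectors_def res_one_eq numeral_3_eq_3)
  have "[1, 1, 1] \<in> carrier (vectors (residue_ring 2) 3)"
    by (simp add: vectors_def res_carrier_eq)
  moreover have "weight (residue_ring 2) [1, 1, 1] = 1"
    by (subst weight_res_eq) (auto simp: res_carrier_eq)
  moreover have "v a \<otimes>\<^bsub>vectors (residue_ring 2) 3\<^esub> v a = v a" if "a \<in> D" for a
  proof -
    let ?x = "v a"
    have "k = 0 \<or> k = 1" if "k \<in> set ?x" for k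
      using that \<open>a \<in> D\<close> assms(1) by (auto simp: vectors_def res_carrier_eq dest!: PiE_mem)
    then have "?x ! k * ?x ! k mod 2 = ?x ! k" if "k < length ?x" for k
      using nth_mem[OF that] by fastforce
    then show ?thesis
      by (intro nth_equalityI) (auto simp: vectors_def res_mult_eq)
  qed
  ultimately show ?thesis
    using assms submodule_vectors[of 3] unfolding V2_minion_def
    by (auto simp: one[symmetric] res_one_eq res_zero_eq PiE_mem intro!: exI[of _ 3])
qed

lemma Z_minion_sum:
  assumes "m \<ge> 2" "finite D" "f \<in> obj (Z_minion m) D"
  shows "(\<Sum>a\<in>D. f a) mod int m = 1"
proof -
  interpret residues "int m" "Zmod m"
    using assms by unfold_locales auto
  show ?thesis
    using assms finsum_res_eq[of D f] by (auto simp: Z_minion_def res_one_eq)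
qed

theorem proposition4p7:
  shows "\<not> (\<exists>\<xi>. minion_hom (V2_minion 2 :: ('a::infinite, 'a V2_elem) minion_data) (Z_minion 8) \<xi>)"
proof
  assume "\<exists>\<xi>. minion_hom (V2_minion 2 :: ('a, 'a V2_elem) minion_data) (Z_minion 8) \<xi>"
  then obtain \<xi> where hom: "minion_hom (V2_minion 2 :: ('a, 'a V2_elem) minion_data) (Z_minion 8) \<xi>"
    by blast
  interpret residues 2 "residue_ring 2"
    by unfold_locales auto
  interpret cring "residue_ring 2" by (rule cring)
  let ?M = "vectors (residue_ring 2) 3"
  interpret v: cring ?M by (rule cring_vectors)
  let ?T = "\<lambda>v :: 'a \<Rightarrow> int list. (carrier ?M, [1, 1, 1], v)"
  \<comment> \<open>The largest tuple, \<open>?Q\<close>, has four entries: one \<open>e\<close> and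
    three copies of \<open>u\<close>.\<close>
  obtain S :: "'a set" where "finite S" "card S = 4"
    using infinite_arbitrarily_large[OF infinite_UNIV] by blast
  then obtain a b c d where "S = {a, b, c, d}" "distinct [a, b, c, d]"
    by (auto simp: card_Suc_eq numeral_eq_Suc)
  then have d: "a \<noteq> b" "a \<noteq> c" "a \<noteq> d" "b \<noteq> c" "b \<noteq> d" "c \<noteq> d" by auto
  note d = d d[symmetric]
  have M: "[x, y, z] \<in> carrier ?M \<longleftrightarrow> {x, y, z} \<subseteq> {0, 1}" for x y z
    by (auto simp: vectors_def res_carrier_eq)
  have add: "[x, y, z] \<oplus>\<^bsub>?M\<^esub> [x', y', z'] = [(x + x') mod 2, (y + y') mod 2, (z + z') mod 2]"
    for x y z x' y' z' by (simp add: vectors_def res_add_eq)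
  have mod_add3: "(x + (y mod 2 + z mod 2)) mod 2 = (x + (y + z)) mod 2" for x y z :: int
    by presburger
  have weight_mult: "weight (residue_ring 2) ([x, y, z] \<otimes>\<^bsub>?M\<^esub> [x', y', z'])
      = (x * x' + y * y' + z * z') mod 2"
    for x y z x' y' z'
    by (subst weight_res_eq) (auto simp: vectors_def res_mult_eq res_carrier_eq mod_simps add.assoc mod_add3)
  let ?e1 = "[1, 0, 0] :: int list" and ?e2 = "[0, 1, 0] :: int list" and ?e3 = "[0, 0, 1] :: int list"
  let ?E = "\<lambda>t\<in>{a, b, c}. if t = a then ?e1 else if t = b then ?e2 else ?e3"
  let ?P = "\<lambda>e u. \<lambda>t\<in>{a, b}. if t = a then e else u"
  let ?Q = "\<lambda>e u. \<lambda>t\<in>{a, b, c, d}. if t = a then e else u"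
  have sum: "(\<Sum>t\<in>D. \<xi> D (?T v) t) mod 8 = 1" if "finite D" "?T v \<in> obj (V2_minion 2) D" for D v
  proof -
    have "\<xi> D (?T v) \<in> obj (Z_minion 8) D"
      using that by (intro minion_hom_closed[OF hom])
    then show ?thesis using Z_minion_sum[of 8 D] that by auto
  qed
  note value_eq = minion_hom_value_eq[OF hom]
  have E: "?T ?E \<in> obj (V2_minion 2) {a, b, c}"
    by (rule V2_minion_2_objI) (use d in \<open>auto simp: M v.finsum_insert add weight_mult\<close>)
  \<comment> \<open>Stated for any triple with a unit vector as an entry, so that it applies to each
    entry of \<open>?E\<close>.\<close>
  have double: "2 * \<xi> D (?T v) t mod 8 = 2"
    if v: "finite D" "?T v \<in> obj (V2_minion 2) D" "t \<in> D"
      and vt: "v t \<in> {?e1, ?e2, ?e3}"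
    for D v t
  proof -
    obtain e where ve: "v t = e" by blast
    \<comment> \<open>\<open>u\<close> is the complement of \<open>e\<close> in (1,1,1).\<close>
    then obtain u :: "int list" where
      e: "(e, u) \<in> {(?e1, [0, 1, 1]), (?e2, [1, 0, 1]), (?e3, [1, 1, 0])}"
      using vt by blast
    have P: "?T (?P e u) \<in> obj (V2_minion 2) {a, b}"
      by (rule V2_minion_2_objI) (use d e in \<open>auto simp: M v.finsum_insert add weight_mult\<close>)
    \<comment> \<open>Since 3 is 1 modulo 2, three copies of \<open>u\<close> sum to
      \<open>u\<close>. They are mutually orthogonal because \<open>u\<close> has exactly two
      ones.\<close>
    have Q: "?T (?Q e u) \<in> obj (V2_minion 2) {a, b, c, d}"
      by (rule V2_minion_2_objI) (use d e in \<open>auto simp: M v.finsum_insert add weight_mult\<close>)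
    let ?x = "\<xi> D (?T v) t" and ?y = "\<xi> {a, b} (?T (?P e u)) b"
    have "\<xi> {a, b} (?T (?P e u)) a = ?x"
      by (rule value_eq[OF _ _ _ P _ v(1,2,3)]) (use ve in auto)
    then have "(?x + ?y) mod 8 = 1"
      using sum[OF _ P] d by simp
    moreover have "\<xi> {a, b, c, d} (?T (?Q e u)) a = ?x"
      by (rule value_eq[OF _ _ _ Q _ v(1,2,3)]) (use ve in auto)
    moreover have "\<xi> {a, b, c, d} (?T (?Q e u)) s = ?y" if "s \<in> {b, c, d}" for s
      by (rule value_eq[OF _ _ _ Q _ _ P]) (use that d in auto)
    ultimately have "(?x + ?y) mod 8 = 1" "(?x + 3 * ?y) mod 8 = 1"
      using sum[OF _ Q] d by auto
    \<comment> \<open>Subtracting the congruences gives 2 \<open>?y\<close> = 0 modulo 8; doubling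
      the first then gives 2 \<open>?x\<close> = 2.\<close>
    then show ?thesis by presburger
  qed
  let ?f = "\<xi> {a, b, c} (?T ?E)"
  have "2 * ?f t mod 8 = 2" if "t \<in> {a, b, c}" for t
    using that by (intro double[OF _ E]) auto
  then have "2 * ?f a mod 8 = 2" "2 * ?f b mod 8 = 2" "2 * ?f c mod 8 = 2"
    by blast+
  moreover have "(?f a + ?f b + ?f c) mod 8 = 1"
    using sum[OF _ E] d by (simp add: add.assoc)
  \<comment> \<open>Each of the three numbers is 1 modulo 4, so their sum is 3 modulo 4.\<close>
  moreover have "(x + y + z) mod 8 \<noteq> 1"
    if "2 * x mod 8 = 2" "2 * y mod 8 = 2" "2 * z mod 8 = 2" for x y z :: int
    using that by presburger
  ultimately show False by blast
qed

end
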